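(* Let $k$ and $l$ be integers such that either $k$ is even and $l\ge 3$ is odd with $k\ge 2l-2$, or $k$ is odd and $l\ge 2$ is even with $k\ge 2l+1$. If $C\in\mathcal{F}\left(\frac{3k}{2}+\frac{l+1}{2},\,k,\,k+l\right)$ is symmetric, then $|C|\le 4k+2(l+1)$.
   Context: $I(d)$ is the graph of the $d$-dimensional hypercube (vertices are binary vectors of length $d$; edges join vectors differing in exactly one position). For a graph $G$, $d_G(x,y)$ is the graph distance in $G$. A circuit in $I(d)$ is a simple cycle $C=(x_1,\ldots,x_N)$ in $I(d)$; its length is $|C|=N$. A $(d,k)$ circuit code (circuit code of spread $k$ in dimension $d$) is a circuit $C$ in $I(d)$ such that for all vertices $x,y$ of $C$, $d_{I(d)}(x,y)<k$ implies $d_C(x,y)=d_{I(d)}(x,y)$. The transition sequence of $C$ is $T=(\tau_1,\ldots,\tau_N)$, where $\tau_i\in\{1,\ldots,d\}$ is the position in which $x_i$ and $x_{i+1}$ differ (indices mod $N$). A segment of $T$ is a subsequence of cyclically consecutive elements of $T$. The maximum bit run $\phi(C)$ is the length of the longest segment of $T$ in which no transition is repeated. $\mathcal{F}(d,k,r)$ is the set of $(d,k)$ circuit codes $C$ with $\phi(C)\ge r$. A circuit code is symmetric if its transition sequence satisfies $\tau_i=\tau_{i+N/2}$ for $1\le i\le N/2$ ($N$ is always even since $I(d)$ is bipartite). *)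

theory Defs
  imports Main
begin

text \<open>
  Binary vectors of length \<open>d\<close> are lists of type \<^typ>\<open>bool list\<close>; graphs are symmetric edge
  relations. Positions and indices are counted from 0, so transitions lie in \<open>{0..<d}\<close>.
\<close>

definition hypercube :: "nat \<Rightarrow> (bool list \<times> bool list) set" where
  "hypercube d = {(x, y). length x = d \<and> length y = d \<and> (\<exists>!p. p < d \<and> x ! p \<noteq> y ! p)}"

text \<open>
  The length of a shortest walk. The value is meaningful only if \<open>x\<close> and \<open>y\<close> lie in the same
  connected component, as they always do for vertices of a hypercube or of a cycle.
\<close>

definition graph_dist :: "('a \<times> 'a) set \<Rightarrow> 'a \<Rightarrow> 'a \<Rightarrow> nat" where
  "graph_dist E x y = (LEAST n. (x, y) \<in> E ^^ n)"

definition cycle_graph :: "'a list \<Rightarrow> ('a \<times> 'a) set" where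
  "cycle_graph C = (let E = {(C ! i, C ! (Suc i mod length C)) | i. i < length C} in E \<union> E\<inverse>)"

definition circuit :: "nat \<Rightarrow> bool list list \<Rightarrow> bool" where
  "circuit d C \<longleftrightarrow> 3 \<le> length C \<and> distinct C \<and> cycle_graph C \<subseteq> hypercube d"

definition circuit_code :: "nat \<Rightarrow> nat \<Rightarrow> bool list list \<Rightarrow> bool" where
  "circuit_code d k C \<longleftrightarrow> circuit d C \<and>
     (\<forall>x \<in> set C. \<forall>y \<in> set C. graph_dist (hypercube d) x y < k \<longrightarrow>
        graph_dist (cycle_graph C) x y = graph_dist (hypercube d) x y)"

definition transition :: "bool list \<Rightarrow> bool list \<Rightarrow> nat" where
  "transition x y = (THE p. p < length x \<and> x ! p \<noteq> y ! p)"

definition transition_sequence :: "bool list list \<Rightarrow> nat list" where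
  "transition_sequence C =
     map (\<lambda>i. transition (C ! i) (C ! (Suc i mod length C))) [0..<length C]"

text \<open>Segments may wrap around the end of the sequence, but are never longer than it.\<close>

definition segments :: "'a list \<Rightarrow> 'a list set" where
  "segments T = {take m (rotate i T) | i m. m \<le> length T}"

definition max_bit_run :: "bool list list \<Rightarrow> nat" where
  "max_bit_run C = Max {length s | s. s \<in> segments (transition_sequence C) \<and> distinct s}"

definition circuit_codes_with_run :: "nat \<Rightarrow> nat \<Rightarrow> nat \<Rightarrow> bool list list set" where
  "circuit_codes_with_run d k r = {C. circuit_code d k C \<and> r \<le> max_bit_run C}"

text \<open>The halving is exact: hypercubes are bipartite, so circuits have even length.\<close>

definition symmetric_code :: "bool list list \<Rightarrow> bool" where
  "symmetric_code C \<longleftrightarrow>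
     (\<forall>i < length C div 2. transition_sequence C ! i = transition_sequence C ! (i + length C div 2))"

end

theory Submission
  imports Defs
begin

text \<open>
  Put \<open>M = |C| div 2\<close> and \<open>n = k + l\<close>, let the run occupy the first \<open>n\<close> transitions, and suppose
  \<open>M > n + k\<close>. Every vertex \<open>x\<^sub>i\<close> at circuit distance at least \<open>k\<close> from \<open>x\<^sub>0\<close> and \<open>x\<^sub>n\<close> has cube
  distance at least \<open>k\<close> from both, while \<open>d(x\<^sub>0,x\<^sub>i) + d(x\<^sub>n,x\<^sub>i) + d(x\<^sub>0,x\<^sub>n) \<le> 2d = 3k + l + 1\<close>.
  As \<open>k + l\<close> is odd, the two distances are \<open>k\<close> and \<open>k + 1\<close> in some order, and \<open>x\<^sub>i\<close> differs from
  \<open>x\<^sub>0\<close> in every position outside the run. By symmetry the set \<open>P\<close> of positions in which \<open>x\<^sub>i\<close>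
  and \<open>x\<^bsub>i+M\<^esub>\<close> differ does not depend on \<open>i\<close>, so \<open>|P|\<close> is \<open>k\<close> or \<open>k + 1\<close>. In the first case
  removing one transition in \<open>P\<close> from a half period leaves two distant vertices at distance
  \<open>k - 1\<close>. In the second case the alternation of \<open>d(x\<^sub>0,x\<^sub>i)\<close> around \<open>i = M + n\<close> puts the two
  consecutive transitions at \<open>n - 1\<close> and \<open>n\<close> into \<open>P\<close>, and removing both again leaves distance
  \<open>k - 1\<close>.
\<close>

definition differing :: "nat \<Rightarrow> bool list \<Rightarrow> bool list \<Rightarrow> nat set" where
  "differing d x y = {p. p < d \<and> x ! p \<noteq> y ! p}"

lemma finite_differing [simp]: "finite (differing d x y)"
  by (simp add: differing_def)

section \<open>Walks in the hypercube\<close>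

text \<open>Time runs over all naturals: a circuit is unrolled periodically, so that it can be
  restarted at any vertex without modular arithmetic.\<close>

locale cube_walk =
  fixes d :: nat and X :: "nat \<Rightarrow> bool list" and T :: "nat \<Rightarrow> nat"
  assumes T_less: "T i < d"
    and flip: "p < d \<Longrightarrow> X (Suc i) ! p \<longleftrightarrow> (X i ! p \<noteq> (p = T i))"
begin

abbreviation dst :: "nat \<Rightarrow> nat \<Rightarrow> nat" where
  "dst i j \<equiv> card (differing d (X i) (X j))"

lemma dst_Suc_eq:
  assumes "X i ! T j = X j ! T j"
  shows "dst i (Suc j) = Suc (dst i j)"
proof -
  have "differing d (X i) (X (Suc j)) = insert (T j) (differing d (X i) (X j))"
    using assms T_less[of j] by (auto simp: differing_def flip)
  moreover have "T j \<notin> differing d (X i) (X j)"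
    using assms by (simp add: differing_def)
  ultimately show ?thesis by simp
qed

lemma dst_Suc_neq:
  assumes "X i ! T j \<noteq> X j ! T j"
  shows "Suc (dst i (Suc j)) = dst i j"
proof -
  have "differing d (X i) (X j) = insert (T j) (differing d (X i) (X (Suc j)))"
    using assms T_less[of j] by (auto simp: differing_def flip)
  moreover have "T j \<notin> differing d (X i) (X (Suc j))"
    using assms T_less[of j] by (simp add: differing_def flip)
  ultimately show ?thesis by simp
qed

lemma dst_Suc_less_iff: "dst i (Suc j) < dst i j \<longleftrightarrow> X i ! T j \<noteq> X j ! T j"
  using dst_Suc_eq[of i j] dst_Suc_neq[of i j] by linarith

lemma dst_le: "dst i (i + s) \<le> s"
proof (induction s)
  case 0
  then show ?case by (simp add: differing_def)
next
  case (Suc s)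
  then show ?case using dst_Suc_eq[of i "i + s"] dst_Suc_neq[of i "i + s"] by fastforce
qed

lemma even_dst: "even (dst i (i + s)) \<longleftrightarrow> even s"
proof (induction s)
  case 0
  then show ?case by (simp add: differing_def)
next
  case (Suc s)
  then show ?case
    using dst_Suc_eq[of i "i + s"] dst_Suc_neq[of i "i + s"]
    by (metis add_Suc_right even_Suc)
qed

lemma unchanged:
  assumes "p < d" "\<And>j. i \<le> j \<Longrightarrow> j < i + s \<Longrightarrow> T j \<noteq> p"
  shows "X (i + s) ! p = X i ! p"
  using assms(2)
proof (induction s)
  case (Suc s)
  then have "X (i + s) ! p = X i ! p" "T (i + s) \<noteq> p" by simp_all
  then show ?case using flip[OF assms(1), of "i + s"] by auto
qed simp

text \<open>Within the window the position \<open>T j\<close> is flipped at time \<open>j\<close>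
  only; \<open>unchanged\<close> covers the stretches before and after.\<close>

lemma flipped_once:
  assumes "inj_on T {i..<i + s}" "i \<le> j" "j < i + s"
  shows "X (i + s) ! T j \<noteq> X i ! T j"
proof -
  have ne: "T j' \<noteq> T j" if "i \<le> j'" "j' < i + s" "j' \<noteq> j" for j'
    using inj_onD[OF assms(1), of j' j] that assms(2,3) by auto
  have "X (i + (j - i)) ! T j = X i ! T j"
    by (rule unchanged) (use T_less ne assms in auto)
  moreover have "X (Suc j + (i + s - Suc j)) ! T j = X (Suc j) ! T j"
    by (rule unchanged) (use T_less ne assms in auto)
  ultimately show ?thesis
    using assms flip[OF T_less, of j j] by auto
qed

text \<open>Both vertices flip the same position at every step, so their set of differing positions
  never changes.\<close>

lemma shift_by_period:
  assumes "\<And>i. T (i + M) = T i" "p < d"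
  shows "X (i + M) ! p \<longleftrightarrow> (X i ! p \<noteq> (p \<in> differing d (X 0) (X M)))"
proof (induction i)
  case 0
  then show ?case using assms(2) by (auto simp: differing_def)
next
  case (Suc i)
  then show ?case using flip[OF assms(2)] assms(1)[of i] by auto
qed

text \<open>A position in the run separates \<open>X 0\<close> from \<open>X n\<close>, so
  \<open>X j\<close> disagrees there with exactly one of them, which contributes \<open>n\<close> in
  total. Elsewhere \<open>X 0\<close> and \<open>X n\<close> agree, and each disagreement counts
  twice.\<close>

lemma dst_run:
  assumes "inj_on T {..<n}"
  shows "dst 0 j + dst n j = n + 2 * card (differing d (X 0) (X j) - T ` {..<n})"
proof -
  let ?A = "T ` {..<n}"
  let ?D = "differing d (X 0) (X j)" and ?E = "differing d (X n) (X j)"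
  have inA: "X n ! p \<noteq> X 0 ! p" if "p \<in> ?A" for p
    using that flipped_once[of 0 n] assms by (auto simp: lessThan_atLeast0)
  have outA: "X n ! p = X 0 ! p" if "p < d" "p \<notin> ?A" for p
    using that unchanged[of p 0 n] by auto
  have "card (?E \<inter> ?A) = card (?A - ?D)"
    by (rule arg_cong[of _ _ card]) (use inA T_less in \<open>auto simp: differing_def\<close>)
  moreover have "card (?E - ?A) = card (?D - ?A)"
    by (rule arg_cong[of _ _ card]) (use outA in \<open>auto simp: differing_def\<close>)
  moreover have "card ?D = card (?D \<inter> ?A) + card (?D - ?A)" "card ?E = card (?E \<inter> ?A) + card (?E - ?A)"
    by (simp_all add: card_Diff_subset_Int card_mono)
  moreover have "card (?D \<inter> ?A) + card (?A - ?D) = n"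
    using assms card_Int_Diff[of ?A ?D] by (simp add: card_image Int_commute)
  ultimately show ?thesis by linarith
qed

section \<open>Half the length of a symmetric code\<close>

lemma half_length_bound:
  assumes period: "\<And>i. T (i + M) = T i"
    and spread: "\<And>i s. k \<le> s \<Longrightarrow> s + k \<le> 2 * M \<Longrightarrow> k \<le> dst i (i + s)"
    and run: "inj_on T {..<k + l}"
    and dim: "2 * d = 3 * k + l + 1"
    and l: "0 < l" "l < k"
  shows "M \<le> 2 * k + l"
proof (rule ccontr)
  assume "\<not> M \<le> 2 * k + l"
  then have M: "2 * k + l < M" by simp
  define n where "n = k + l"
  define A where "A = T ` {..<n}"
  define P where "P = differing d (X 0) (X M)"
  have A: "finite A" "A \<subseteq> {..<d}" "card A = n"
    using run T_less by (auto simp: A_def n_def card_image)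
  have shift: "X (i + M) ! p \<longleftrightarrow> (X i ! p \<noteq> (p \<in> P))" if "p < d" for i p
    using shift_by_period[OF period that] by (simp add: P_def)
  have P: "finite P" "P \<subseteq> {..<d}"
    by (auto simp: P_def differing_def)
  have far: "dst 0 j + dst n j = 2 * k + 1 \<and> dst 0 j \<in> {k, k + 1} \<and> {..<d} - A \<subseteq> differing d (X 0) (X j)"
    if j: "n + k \<le> j" "j + k \<le> 2 * M" for j
  proof -
    define c where "c = differing d (X 0) (X j) - A"
    have sum: "dst 0 j + dst n j = n + 2 * card c"
      using dst_run[of n j] run by (simp add: c_def A_def n_def)
    have c: "c \<subseteq> {..<d} - A" by (auto simp: c_def differing_def)
    have cd: "card ({..<d} - A) = d - n" using A by (simp add: card_Diff_subset)
    have "card c \<le> d - n" using card_mono[OF _ c] cd by simp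
    moreover have ge: "k \<le> dst 0 j" "k \<le> dst n j"
      using spread[of j 0] spread[of "j - n" n] j by simp_all
    \<comment> \<open>The sum is at least \<open>2 * k\<close>, while
      \<open>n + 2 * (d - n) = 2 * k + 1\<close>; hence \<open>card c\<close> falls short of
      \<open>d - n\<close> by less than one.\<close>
    ultimately have cc: "card c = d - n"
      using sum dim l by (simp add: n_def)
    then have "c = {..<d} - A"
      using card_subset_eq[OF _ c] cd by simp
    moreover have "dst 0 j + dst n j = 2 * k + 1"
      using sum cc dim l by (simp add: n_def)
    moreover have "c \<subseteq> differing d (X 0) (X j)"
      unfolding c_def by (rule Diff_subset)
    moreover have "dst 0 j = k \<or> dst 0 j = k + 1"
      using ge \<open>dst 0 j + dst n j = 2 * k + 1\<close> by linarith
    ultimately show ?thesis by simp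
  qed
  have "card P \<in> {k, k + 1}"
    using far[of M] M by (simp add: P_def n_def)
  then consider "card P = k" | "card P = k + 1" by auto
  then show False
  proof cases
    case 1
    \<comment> \<open>Some position lies outside the run, because
      \<open>2 * d - 2 * n = k - l + 1 > 0\<close>.\<close>
    have "card A < card {..<d}" using A dim l by (simp add: n_def)
    then obtain b where b: "b < d" "b \<notin> A"
      using card_mono[OF A(1), of "{..<d}"] by (auto simp: not_le)
    then have bP: "b \<in> P"
      using far[of M] M by (auto simp: P_def n_def)
    then obtain i where i: "T i = b"
      using unchanged[of b 0 M] b by (auto simp: P_def differing_def)
    \<comment> \<open>Starting one step later flips \<open>b\<close> at one end only, which cancels
      that difference.\<close>
    have "differing d (X (Suc i)) (X (i + M)) = P - {b}"
      using P i bP by (auto simp: differing_def flip shift)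
    then have "dst (Suc i) (Suc i + (M - 1)) = k - 1"
      using bP 1 M by simp
    moreover have "k \<le> dst (Suc i) (Suc i + (M - 1))"
      using M l by (intro spread) simp_all
    ultimately show False using l by simp
  next
    case 2
    have "differing d (X n) (X (M + n)) = P"
      using P shift[of _ n] by (auto simp: differing_def add.commute)
    then have at: "dst 0 (M + n) = k"
      using far[of "M + n"] 2 M by (simp add: n_def)
    \<comment> \<open>The index \<open>M + n + 1\<close> is admissible for \<open>far\<close>
      exactly when \<open>n + k + 1 \<le> M\<close>, which is the strict inequality assumed for
      contradiction. Since \<open>dst 0 (M + n)\<close> is the smaller value \<open>k\<close>, the
      distance must fall on arrival there and rise on departure.\<close>
    have near: "dst 0 (Suc (M + n)) \<in> {k, k + 1}" "dst 0 (M + n - 1) \<in> {k, k + 1}"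
      using far[of "Suc (M + n)"] far[of "M + n - 1"] M l by (simp_all add: n_def)
    have npos: "Suc (M + n - 1) = M + n" "Suc (n - 1) = n" using l by (simp_all add: n_def)
    define a where "a = T (n - 1)"
    define e where "e = T n"
    have Ta: "T (M + n - 1) = a" and Te: "T (M + n) = e"
      using period[of "n - 1"] period[of n] npos l by (simp_all add: a_def e_def n_def algebra_simps)
    have "\<not> dst 0 (Suc (M + n)) < dst 0 (M + n)"
      using near(1) at by auto
    then have up: "X 0 ! e = X (M + n) ! e"
      by (simp add: dst_Suc_less_iff Te)
    have "dst 0 (M + n) \<noteq> Suc (dst 0 (M + n - 1))"
      using near(2) at by auto
    then have down: "X 0 ! a \<noteq> X (M + n - 1) ! a"
      using dst_Suc_eq[of 0 "M + n - 1"] unfolding npos Ta by blast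
    have ad: "a < d" "e < d" by (simp_all add: a_def e_def T_less)
    \<comment> \<open>The position \<open>a\<close> belongs to the last transition of the run, so it
      is still untouched at time \<open>n - 1\<close>.\<close>
    have "X (0 + (n - 1)) ! a = X 0 ! a"
    proof (rule unchanged[OF ad(1)])
      fix j assume j: "j < 0 + (n - 1)"
      then have "j < k + l" "n - 1 < k + l" using l by (simp_all add: n_def)
      then show "T j \<noteq> a"
        using inj_onD[OF run, of j "n - 1"] j by (auto simp: a_def)
    qed
    then have aP: "a \<in> P"
      using down shift[OF ad(1), of "n - 1"] npos by (auto simp: algebra_simps)
    \<comment> \<open>Positions outside the run all differ between \<open>X 0\<close> and
      \<open>X (M + n)\<close>, but \<open>e\<close> does not.\<close>
    have "e \<in> A"
    proof (rule ccontr)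
      assume "e \<notin> A"
      then have "e \<in> differing d (X 0) (X (M + n))"
        using far[of "M + n"] M ad by (auto simp: n_def)
      then show False using up by (simp add: differing_def)
    qed
    then have "X n ! e \<noteq> X 0 ! e"
      using flipped_once[of 0 n] run by (auto simp: A_def n_def lessThan_atLeast0)
    then have eP: "e \<in> P"
      using up shift[OF ad(2), of n] by (auto simp: add.commute)
    have two: "X (Suc n) ! p \<longleftrightarrow> (X (n - 1) ! p \<noteq> ((p = a) \<noteq> (p = e)))" if "p < d" for p
      using flip[OF that, of n] flip[OF that, of "n - 1"] npos by (auto simp: a_def e_def)
    \<comment> \<open>Otherwise the two flips cancel, and \<open>k\<close> steps from
      \<open>n - 1\<close> reach distance at most \<open>k - 2\<close>.\<close>
    have "a \<noteq> e"
    proof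
      assume "a = e"
      then have "differing d (X (n - 1)) y = differing d (X (Suc n)) y" for y
        using two by (auto simp: differing_def)
      moreover have "n - 1 + k = Suc n + (k - 2)"
        using l by (simp add: n_def)
      ultimately have "dst (n - 1) (n - 1 + k) \<le> k - 2"
        using dst_le[of "Suc n" "k - 2"] by simp
      moreover have "k \<le> dst (n - 1) (n - 1 + k)"
        using M by (intro spread) simp_all
      ultimately show False using l by linarith
    qed
    have "differing d (X (Suc n)) (X (n - 1 + M)) = P - {a, e}"
      using P aP eP \<open>a \<noteq> e\<close> by (auto simp: differing_def two shift)
    moreover have "n - 1 + M = Suc n + (M - 2)"
      using M l by (simp add: n_def)
    ultimately have "dst (Suc n) (Suc n + (M - 2)) = k - 1"
      using aP eP \<open>a \<noteq> e\<close> 2 P(1) by (simp add: card_Diff_subset)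
    moreover have "k \<le> dst (Suc n) (Suc n + (M - 2))"
      using M l by (intro spread) simp_all
    ultimately show False using l by simp
  qed
qed

end

section \<open>Distances in the two graphs\<close>

text \<open>Correcting the differing positions one by one bounds the graph distance by the Hamming
  distance, the direction through which the spread condition is applied.\<close>

lemma hypercube_walk:
  assumes "length x = d" "length y = d"
  shows "(x, y) \<in> hypercube d ^^ card (differing d x y)"
  using assms
proof (induction "card (differing d x y)" arbitrary: x)
  case 0
  then have "differing d x y = {}" by simp
  then have "x = y" using 0(2,3) by (auto simp: differing_def intro: nth_equalityI)
  then show ?case using 0(1) by simp
next
  case (Suc c)
  then obtain p where p: "p \<in> differing d x y"
    by (metis card.empty equals0I nat.distinct(1))
  then have pd: "p < d" by (simp add: differing_def)
  define z where "z = x[p := y ! p]"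
  have z: "length z = d" "differing d z y = differing d x y - {p}"
    using Suc.prems pd by (auto simp: z_def differing_def nth_list_update)
  then have "(z, y) \<in> hypercube d ^^ card (differing d z y)"
    using Suc p by (intro Suc.hyps(1)) simp_all
  then have "(z, y) \<in> hypercube d ^^ c"
    using Suc(2) z p by (metis card_Diff_singleton diff_Suc_1)
  moreover have "(x, z) \<in> hypercube d"
    using Suc.prems pd p unfolding hypercube_def
    by (auto simp: z_def differing_def nth_list_update intro!: ex1I[of _ p])
  ultimately show ?case using Suc(2) by (metis relpow_Suc_I2)
qed

lemma cycle_graph_iff:
  "(x, y) \<in> cycle_graph C \<longleftrightarrow>
     (\<exists>i < length C. x = C ! i \<and> y = C ! (Suc i mod length C) \<or>
                     y = C ! i \<and> x = C ! (Suc i mod length C))"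
  by (auto simp: cycle_graph_def Let_def)

text \<open>A walk with \<open>p\<close> forward and \<open>q\<close> backward steps; the congruence avoids negative indices.\<close>

lemma cycle_walk_offset:
  assumes "distinct C" "i < length C" "(C ! i, y) \<in> cycle_graph C ^^ t"
  shows "\<exists>j p q. j < length C \<and> y = C ! j \<and> p + q = t \<and> (i + p) mod length C = (j + q) mod length C"
  using assms(3)
proof (induction t arbitrary: y)
  case 0
  then show ?case using assms(2) by auto
next
  case (Suc t)
  then obtain z where "(C ! i, z) \<in> cycle_graph C ^^ t" and zy: "(z, y) \<in> cycle_graph C"
    by auto
  then obtain j p q where j: "j < length C" "z = C ! j" "p + q = t"
    "(i + p) mod length C = (j + q) mod length C"
    using Suc.IH by blast
  from zy obtain h where h: "h < length C"
    "z = C ! h \<and> y = C ! (Suc h mod length C) \<or> y = C ! h \<and> z = C ! (Suc h mod length C)"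
    by (auto simp: cycle_graph_iff)
  have lt: "Suc h mod length C < length C" using h(1) by (intro mod_less_divisor) linarith
  from h(2) show ?case
  proof
    assume *: "z = C ! h \<and> y = C ! (Suc h mod length C)"
    then have "h = j" using assms(1) h j by (simp add: nth_eq_iff_index_eq)
    moreover have "(i + Suc p) mod length C = (Suc j mod length C + q) mod length C"
      using j(4) by (metis add_Suc add_Suc_right mod_Suc_eq mod_add_left_eq)
    ultimately show ?thesis using * lt j(3)
      by (intro exI[of _ "Suc h mod length C"] exI[of _ "Suc p"] exI[of _ q]) simp
  next
    assume *: "y = C ! h \<and> z = C ! (Suc h mod length C)"
    then have "j = Suc h mod length C" using assms(1) lt j by (simp add: nth_eq_iff_index_eq)
    then have "(i + p) mod length C = (h + Suc q) mod length C"
      using j(4) by (simp add: mod_add_left_eq)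
    then show ?thesis using * h(1) j(3)
      by (intro exI[of _ h] exI[of _ p] exI[of _ "Suc q"]) simp
  qed
qed

lemma cycle_walk:
  assumes "C \<noteq> []"
  shows "(C ! (i mod length C), C ! ((i + s) mod length C)) \<in> cycle_graph C ^^ s"
proof (induction s)
  case (Suc s)
  have "(C ! ((i + s) mod length C), C ! ((i + Suc s) mod length C)) \<in> cycle_graph C"
    using assms unfolding cycle_graph_iff
    by (intro exI[of _ "(i + s) mod length C"]) (simp add: mod_Suc_eq)
  with Suc show ?case by auto
qed simp

text \<open>Both arcs between the two vertices have length at least \<open>k\<close>.\<close>

lemma cycle_dist_ge:
  assumes "distinct C" "C \<noteq> []" "k \<le> s" "s + k \<le> length C"
  shows "k \<le> graph_dist (cycle_graph C) (C ! (i mod length C)) (C ! ((i + s) mod length C))"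
    (is "_ \<le> ?t")
proof (rule ccontr)
  assume "\<not> k \<le> ?t"
  then have t: "?t < k" by simp
  have N: "0 < length C" using assms(2) by simp
  have "(C ! (i mod length C), C ! ((i + s) mod length C)) \<in> cycle_graph C ^^ ?t"
    unfolding graph_dist_def using cycle_walk[OF assms(2)] by (rule LeastI)
  then obtain j p q where j: "j < length C" "C ! ((i + s) mod length C) = C ! j" "p + q = ?t"
    "(i mod length C + p) mod length C = (j + q) mod length C"
    using cycle_walk_offset[OF assms(1)] N by (metis mod_less_divisor)
  then have "j = (i + s) mod length C"
    using assms(1) N by (simp add: nth_eq_iff_index_eq)
  then have "(i + (s + q)) mod length C = (i + p) mod length C"
    using j(4) by (simp add: mod_add_left_eq add.assoc)
  then have "length C dvd (i + (s + q)) - (i + p)"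
    using t j(3) assms(3) by (simp add: mod_eq_dvd_iff_nat)
  then have "length C dvd s + q - p" by simp
  \<comment> \<open>From \<open>p + q < k \<le> s\<close> and \<open>s + k \<le> length C\<close>
    the multiple \<open>s + q - p\<close> lies strictly between 0 and
    \<open>length C\<close>.\<close>
  then show False using t j(3) assms(3,4) by (auto dest!: dvd_imp_le)
qed

lemma circuit_code_dist_ge:
  assumes "circuit_code d k C" "k \<le> s" "s + k \<le> length C"
  shows "k \<le> card (differing d (C ! (i mod length C)) (C ! ((i + s) mod length C)))"
proof (rule ccontr)
  let ?x = "C ! (i mod length C)" and ?y = "C ! ((i + s) mod length C)"
  assume "\<not> ?thesis"
  then have small: "card (differing d ?x ?y) < k" by simp
  have C: "distinct C" "C \<noteq> []" "cycle_graph C \<subseteq> hypercube d"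
    using assms(1) by (auto simp: circuit_code_def circuit_def)
  have mem: "C ! (j mod length C) \<in> set C" for j using C(2) by simp
  have len: "length (C ! (j mod length C)) = d" for j
    using cycle_walk[OF C(2), of j 1] C(3) by (auto simp: hypercube_def)
  have "graph_dist (hypercube d) ?x ?y \<le> card (differing d ?x ?y)"
    unfolding graph_dist_def by (intro Least_le hypercube_walk len)
  then have "graph_dist (hypercube d) ?x ?y < k" using small by simp
  then have "graph_dist (cycle_graph C) ?x ?y < k"
    using assms(1) mem by (simp add: circuit_code_def)
  then show False
    using cycle_dist_ge[OF C(1,2) assms(2,3), of i] by simp
qed

section \<open>From circuit codes to cube walks\<close>

lemma circuit_cube_walk:
  assumes "circuit d C"
  shows "cube_walk d (\<lambda>i. C ! (i mod length C)) (\<lambda>i. transition_sequence C ! (i mod length C))"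
proof
  fix i
  have N: "0 < length C" using assms by (auto simp: circuit_def)
  let ?x = "C ! (i mod length C)" and ?y = "C ! (Suc i mod length C)"
  have "(?x, ?y) \<in> hypercube d"
    using cycle_walk[of C i 1] N assms by (auto simp: circuit_def)
  then have len: "length ?x = d" and ex1: "\<exists>!p. p < d \<and> ?x ! p \<noteq> ?y ! p"
    by (auto simp: hypercube_def)
  have t: "transition_sequence C ! (i mod length C) = transition ?x ?y"
    using N by (simp add: transition_sequence_def mod_Suc_eq)
  have tp: "transition ?x ?y < d \<and> ?x ! transition ?x ?y \<noteq> ?y ! transition ?x ?y"
    using theI'[OF ex1] by (simp add: transition_def len)
  then show "transition_sequence C ! (i mod length C) < d" by (simp add: t)
  fix p assume "p < d"
  then show "?y ! p \<longleftrightarrow> (?x ! p \<noteq> (p = transition_sequence C ! (i mod length C)))"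
    using ex1 tp unfolding t by metis
qed

lemma max_bit_run_attained:
  assumes "C \<noteq> []" "r \<le> max_bit_run C"
  obtains i where "inj_on (\<lambda>j. transition_sequence C ! ((i + j) mod length C)) {..<r}"
proof -
  let ?T = "transition_sequence C"
  let ?L = "{length s | s. s \<in> segments ?T \<and> distinct s}"
  have len: "length ?T = length C" by (simp add: transition_sequence_def)
  \<comment> \<open>\<open>Max\<close> is meaningful only on a finite nonempty set; the empty
    segment is a witness.\<close>
  have "[] \<in> segments ?T" by (force simp: segments_def)
  then have "?L \<noteq> {}" by auto
  moreover have "finite ?L"
    by (rule finite_subset[of _ "{..length C}"]) (auto simp: segments_def len)
  ultimately have "max_bit_run C \<in> ?L"
    unfolding max_bit_run_def by (rule Max_in[rotated])
  then obtain m i where m: "m \<le> length C" "distinct (take m (rotate i ?T))" "r \<le> m"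
    using assms(2) by (auto simp: segments_def len)
  have nth: "take m (rotate i ?T) ! j = ?T ! ((i + j) mod length C)" if "j < r" for j
    using that m by (simp add: nth_rotate len)
  have "inj_on (\<lambda>j. ?T ! ((i + j) mod length C)) {..<r}"
  proof (rule inj_onI)
    fix j j'
    assume "j \<in> {..<r}" "j' \<in> {..<r}" "?T ! ((i + j) mod length C) = ?T ! ((i + j') mod length C)"
    then show "j = j'"
      using m nth_eq_iff_index_eq[OF m(2), of j j'] nth by (simp add: len)
  qed
  then show thesis by (rule that)
qed

theorem lemma3p6:
  fixes k l :: nat and C :: "bool list list"
  assumes "(even k \<and> odd l \<and> l \<ge> 3 \<and> k \<ge> 2 * l - 2) \<or> (odd k \<and> even l \<and> l \<ge> 2 \<and> k \<ge> 2 * l + 1)"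
    and "C \<in> circuit_codes_with_run ((3 * k + l + 1) div 2) k (k + l)"
    and "symmetric_code C"
  shows "length C \<le> 4 * k + 2 * (l + 1)"
proof -
  define d where "d = (3 * k + l + 1) div 2"
  define N where "N = length C"
  define M where "M = N div 2"
  have l: "0 < l" "l < k" using assms(1) by auto
  have "even (3 * k + l + 1)" using assms(1) by auto
  then have dim: "2 * d = 3 * k + l + 1" by (simp add: d_def)
  have code: "circuit_code d k C" and run: "k + l \<le> max_bit_run C"
    using assms(2) by (simp_all add: circuit_codes_with_run_def d_def)
  then have circ: "circuit d C" by (simp add: circuit_code_def)
  then have N: "0 < N" by (auto simp: circuit_def N_def)
  let ?X = "\<lambda>i. C ! (i mod N)" and ?T = "\<lambda>i. transition_sequence C ! (i mod N)"
  interpret W: cube_walk d ?X ?T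
    using circuit_cube_walk[OF circ] by (simp add: N_def)
  \<comment> \<open>The walk closes up after \<open>N\<close> steps, at distance 0.\<close>
  have "even (W.dst 0 (0 + N)) \<longleftrightarrow> even N" by (rule W.even_dst)
  then have "even N" by (simp add: differing_def)
  then have NM: "N = 2 * M" by (simp add: M_def)
  have period: "?T (i + M) = ?T i" for i
  proof -
    have sym: "transition_sequence C ! j = transition_sequence C ! (j + M)" if "j < M" for j
      using assms(3) that by (simp add: symmetric_code_def M_def N_def)
    have "i mod N < N" using N by simp
    then consider "i mod N < M" | h where "i mod N = h + M" "h < M"
      using NM by (metis add.commute le_Suc_ex mult_2 nat_add_left_cancel_less not_le)
    then show ?thesis
    proof cases
      case 1
      then have "(i + M) mod N = i mod N + M"
        using NM by (metis add_less_cancel_right mod_add_left_eq mod_less mult_2)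
      then show ?thesis using sym[OF 1] by simp
    next
      case 2
      have "(i + M) mod N = (h + N) mod N"
        using 2 NM by (metis add.assoc mod_add_left_eq mult_2)
      then have "(i + M) mod N = h" using 2 NM by simp
      then show ?thesis using sym[OF 2(2)] 2(1) by simp
    qed
  qed
  obtain i0 where i0: "inj_on (\<lambda>j. ?T (i0 + j)) {..<k + l}"
    using max_bit_run_attained[OF _ run] N by (auto simp: N_def)
  \<comment> \<open>Restarting at \<open>i0\<close> moves the run to the first \<open>k + l\<close>
    transitions.\<close>
  interpret V: cube_walk d "\<lambda>i. ?X (i0 + i)" "\<lambda>i. ?T (i0 + i)"
    by unfold_locales (use W.T_less W.flip in simp_all)
  have "M \<le> 2 * k + l"
  proof (rule V.half_length_bound[OF _ _ i0 dim l])
    show "?T (i0 + (i + M)) = ?T (i0 + i)" for i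
      using period[of "i0 + i"] by (simp add: add.assoc)
    show "k \<le> V.dst i (i + s)" if "k \<le> s" "s + k \<le> 2 * M" for i s
      using circuit_code_dist_ge[OF code that(1), of "i0 + i"] that(2) NM
      by (simp add: N_def add.assoc)
  qed
  then show ?thesis using NM by (simp add: N_def)
qed

end
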